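(* Let $X$ and $Y$ be finite $\mathbb{Z}_2$-CW-complexes. If there is a $\mathbb{Z}_2$-map from $X\times Y$ to $S^1$, then there is a $\mathbb{Z}_2$-map from $X$ to $S^1$ or there is a $\mathbb{Z}_2$-map from $Y$ to $S^1$.
   Context: A $\mathbb{Z}_2$-map is a continuous $\mathbb{Z}_2$-equivariant map. $S^1$ is a $\mathbb{Z}_2$-space via the antipodal map, and $X\times Y$ carries the diagonal $\mathbb{Z}_2$-action. *)

theory Defs
  imports "HOL-Analysis.Analysis"
begin

definition z2_space :: "'a topology \<Rightarrow> ('a \<Rightarrow> 'a) \<Rightarrow> bool" where
  "z2_space X \<tau> \<longleftrightarrow>
     continuous_map X X \<tau> \<and> (\<forall>x\<in>topspace X. \<tau> (\<tau> x) = x)"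

definition z2_map ::
  "'a topology \<Rightarrow> ('a \<Rightarrow> 'a) \<Rightarrow> 'b topology \<Rightarrow> ('b \<Rightarrow> 'b) \<Rightarrow> ('a \<Rightarrow> 'b) \<Rightarrow> bool" where
  "z2_map X \<tau> Y \<sigma> f \<longleftrightarrow>
     continuous_map X Y f \<and> (\<forall>x\<in>topspace X. f (\<tau> x) = \<sigma> (f x))"

definition disc :: "nat \<Rightarrow> (nat \<Rightarrow> real) topology" where
  "disc n = subtopology (Euclidean_space n) {v. (\<Sum>i<n. (v i)\<^sup>2) \<le> 1}"

definition disc_interior :: "nat \<Rightarrow> (nat \<Rightarrow> real) set" where
  "disc_interior n = {v \<in> topspace (disc n). (\<Sum>i<n. (v i)\<^sup>2) < 1}"

definition disc_boundary :: "nat \<Rightarrow> (nat \<Rightarrow> real) set" where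
  "disc_boundary n = {v \<in> topspace (disc n). (\<Sum>i<n. (v i)\<^sup>2) = 1}"

(* The two orbit types of Z_2: a free orbit Z_2/1 (b = True), modelled by the two
   elements of bool interchanged by negation, and a fixed point Z_2/Z_2 (b = False),
   modelled by {False} with the trivial action. *)

definition orbit_set :: "bool \<Rightarrow> bool set" where
  "orbit_set b = (if b then UNIV else {False})"

definition orbit_action :: "bool \<Rightarrow> bool \<Rightarrow> bool" where
  "orbit_action b = (if b then Not else id)"

definition cell_space :: "nat \<Rightarrow> bool \<Rightarrow> (bool \<times> (nat \<Rightarrow> real)) topology" where
  "cell_space n b = prod_topology (discrete_topology (orbit_set b)) (disc n)"

definition cell_action :: "bool \<Rightarrow> bool \<times> (nat \<Rightarrow> real) \<Rightarrow> bool \<times> (nat \<Rightarrow> real)" where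
  "cell_action b = map_prod (orbit_action b) id"

(* An equivariant cell: its dimension n, its orbit type b, and its characteristic map
   Z_2/H x D^n -> X. *)
type_synonym 'a z2_cell = "nat \<times> bool \<times> (bool \<times> (nat \<Rightarrow> real) \<Rightarrow> 'a)"

definition open_cell :: "'a z2_cell \<Rightarrow> 'a set" where
  "open_cell = (\<lambda>(n, b, \<phi>). \<phi> ` (orbit_set b \<times> disc_interior n))"

(* K is the set of cells of an equivariant CW structure on X, in the style of Whitehead:
   X is Hausdorff and the disjoint union of the open cells, each of which is the
   injective image of Z_2/H x int D^n; the boundary of an n-cell lies in finitely many
   cells of dimension < n; and X carries the weak topology. *)
definition z2_cw_structure :: "'a topology \<Rightarrow> ('a \<Rightarrow> 'a) \<Rightarrow> 'a z2_cell set \<Rightarrow> bool" where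
  "z2_cw_structure X \<tau> K \<longleftrightarrow>
     z2_space X \<tau> \<and> Hausdorff_space X \<and>
     (\<forall>(n, b, \<phi>)\<in>K.
        z2_map (cell_space n b) (cell_action b) X \<tau> \<phi> \<and>
        inj_on \<phi> (orbit_set b \<times> disc_interior n) \<and>
        (\<exists>F\<subseteq>K. finite F \<and> (\<forall>(m, _, _)\<in>F. m < n) \<and>
           \<phi> ` (orbit_set b \<times> disc_boundary n) \<subseteq> (\<Union>c\<in>F. open_cell c))) \<and>
     pairwise (\<lambda>c d. disjnt (open_cell c) (open_cell d)) K \<and>
     (\<Union>c\<in>K. open_cell c) = topspace X \<and>
     (\<forall>A\<subseteq>topspace X.
        (\<forall>(n, b, \<phi>)\<in>K.
           closedin (cell_space n b) {p \<in> topspace (cell_space n b). \<phi> p \<in> A}) \<longrightarrow>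
        closedin X A)"

definition finite_z2_cw_complex :: "'a topology \<Rightarrow> ('a \<Rightarrow> 'a) \<Rightarrow> bool" where
  "finite_z2_cw_complex X \<tau> \<longleftrightarrow> (\<exists>K. finite K \<and> z2_cw_structure X \<tau> K)"

abbreviation circle :: "complex topology" where
  "circle \<equiv> top_of_set (sphere 0 1)"

end

theory Submission
  imports Defs
begin

text \<open>A finite complex is compact with finitely many components, all open, and a
  component that the involution moves is no obstruction to a map to the circle. So it suffices
  to treat connected \<open>X\<close> and \<open>Y\<close>. There the restrictions \<open>a(x) = f(x, y0)\<close> and
  \<open>b(y) = f(x0, y)\<close> determine \<open>f\<close> up to homotopy:
  \<open>f(x, y) f(x0, y0) = a(x) b(y) cis (\<theta>(x, y))\<close> with \<open>\<theta>\<close> continuous and real.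
  Equivariance of \<open>f\<close> then gives \<open>a(\<tau> x) = a(x) cis (\<alpha>(x))\<close> and
  \<open>b(\<sigma> y) = b(y) cis (\<beta>(y))\<close>, where \<open>\<alpha>(x) + \<alpha>(\<tau> x) = 2 \<pi> m\<close> and
  \<open>\<beta>(y) + \<beta>(\<sigma> y) = 2 \<pi> n\<close> are constant. If \<open>m\<close> is odd, \<open>a(x) cis (\<alpha>(x) / 2)\<close> is
  equivariant, and likewise for \<open>n\<close>. The sign in \<open>f(\<tau> x, \<sigma> y) = - f(x, y)\<close> forces
  \<open>m + n\<close> to be odd.\<close>

subsection \<open>Components of finite equivariant complexes\<close>

text \<open>This passes to the function type \<open>nat \<Rightarrow> real\<close>, where the
  type-class notions \<open>closed\<close>, \<open>compact\<close> and \<open>connected\<close> are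
  available.\<close>

lemma disc_eq_top_of_set:
  "disc n = top_of_set {v. (\<forall>i\<ge>n. v i = 0) \<and> (\<Sum>i<n. (v i)\<^sup>2) \<le> 1}"
  by (simp add: disc_def Euclidean_space_def subtopology_subtopology
      euclidean_product_topology Collect_conj_eq)

text \<open>The disc is a closed subset of the cube of all functions with values in
  \<open>{-1..1}\<close>, which is compact by Tychonoff. Coordinates from \<open>n\<close> on vanish
  and so lie in the cube too.\<close>

lemma compact_space_disc: "compact_space (disc n)"
proof -
  let ?D = "{v::nat \<Rightarrow> real. (\<forall>i\<ge>n. v i = 0) \<and> (\<Sum>i<n. (v i)\<^sup>2) \<le> 1}"
  have cl: "closed ?D"
    by (intro closed_Collect_conj closed_Collect_all closed_Collect_imp open_Collect_const
        closed_Collect_eq closed_Collect_le continuous_intros continuous_on_product_coordinates)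
  have "v i \<in> {-1..1}" if "v \<in> ?D" for v i
  proof (cases "i < n")
    case True
    have "(v i)\<^sup>2 \<le> (\<Sum>i<n. (v i)\<^sup>2)"
      using True by (intro member_le_sum) auto
    also have "\<dots> \<le> 1" using that by simp
    finally show ?thesis by (simp add: abs_square_le_1 abs_le_iff)
  qed (use that in auto)
  then have sub: "?D \<subseteq> PiE UNIV (\<lambda>_. {-1..1})"
    by (auto simp: PiE_def Pi_def)
  have "compactin (product_topology (\<lambda>_. euclideanreal) UNIV) (PiE UNIV (\<lambda>_::nat. {-1..1}))"
    by (simp add: compactin_PiE)
  then have "compact (PiE UNIV (\<lambda>_::nat. {-1..1::real}))"
    by (simp add: euclidean_product_topology)
  from compact_Int_closed[OF this cl] have "compact ?D"
    unfolding Int_absorb1[OF sub] .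
  then show ?thesis
    by (simp add: disc_eq_top_of_set compact_space_subtopology)
qed

text \<open>The disc is star-shaped: the segment \<open>?p\<close> joins the origin to any given
  point inside it.\<close>

lemma connected_space_disc: "connected_space (disc n)"
proof -
  let ?D = "{v::nat \<Rightarrow> real. (\<forall>i\<ge>n. v i = 0) \<and> (\<Sum>i<n. (v i)\<^sup>2) \<le> 1}"
  have star: "\<exists>T. connected T \<and> (\<lambda>_. 0) \<in> T \<and> v \<in> T \<and> T \<subseteq> ?D" if v: "v \<in> ?D" for v
  proof (intro exI conjI)
    let ?p = "\<lambda>(t::real) i. t * v i"
    have "continuous_on {0..1} ?p"
      by (intro continuous_on_coordinatewise_then_product continuous_intros)
    then show "connected (?p ` {0..1})"
      by (intro connected_continuous_image) auto
    show "(\<lambda>_. 0) \<in> ?p ` {0..1}" by (rule image_eqI[of _ _ 0]) auto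
    show "v \<in> ?p ` {0..1}" by (rule image_eqI[of _ _ 1]) auto
    have "(\<Sum>i<n. (t * v i)\<^sup>2) \<le> 1" if "t \<in> {0..1}" for t
    proof -
      have "(\<Sum>i<n. (t * v i)\<^sup>2) \<le> (\<Sum>i<n. (v i)\<^sup>2)"
        using that by (intro sum_mono) (simp add: power_mult_distrib mult_left_le_one_le power_le_one)
      then show ?thesis using v by simp
    qed
    then show "?p ` {0..1} \<subseteq> ?D" using v by auto
  qed
  have "connected (\<Union>{T. connected T \<and> (\<lambda>_. 0) \<in> T \<and> T \<subseteq> ?D})"
    by (rule connected_Union) blast+
  also have "\<Union>{T. connected T \<and> (\<lambda>_. 0) \<in> T \<and> T \<subseteq> ?D} = ?D"
    by (intro equalityI subsetI) (blast, metis (mono_tags, lifting) UnionI mem_Collect_eq star)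
  finally have "connected ?D" .
  then show ?thesis
    by (simp add: disc_eq_top_of_set connected_space_subtopology)
qed

text \<open>The cover consists of the closed cells, which are continuous images of discs.
  Compactness and the finiteness of the set of components are both read off from it.\<close>

lemma finite_z2_cw_complex_cover:
  assumes "finite_z2_cw_complex X \<tau>"
  obtains \<C> where "finite \<C>" "\<forall>C\<in>\<C>. compactin X C \<and> connectedin X C" "topspace X = \<Union>\<C>"
proof -
  obtain K where K: "finite K" "z2_cw_structure X \<tau> K"
    using assms by (auto simp: finite_z2_cw_complex_def)
  \<comment> \<open>A free cell contributes two pieces, one for each \<open>s\<close>, since the
    image of both sheets together may be disconnected.\<close>
  let ?\<C> = "(\<Union>(n, b, \<phi>)\<in>K. (\<lambda>s. \<phi> ` ({s} \<times> topspace (disc n))) ` orbit_set b)"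
  have cont: "continuous_map (cell_space n b) X \<phi>" if "(n, b, \<phi>) \<in> K" for n b \<phi>
    using K that by (fastforce simp: z2_cw_structure_def z2_map_def)
  have comp: "compactin (cell_space n b) ({s} \<times> topspace (disc n))"
    and conn: "connectedin (cell_space n b) ({s} \<times> topspace (disc n))" if "s \<in> orbit_set b" for n b s
    using that compact_space_disc connected_space_disc
    by (auto simp: cell_space_def compactin_Times connectedin_Times compact_space_def
        connectedin_topspace)
  have img: "\<exists>n b \<phi> s. (n, b, \<phi>) \<in> K \<and> s \<in> orbit_set b \<and> C = \<phi> ` ({s} \<times> topspace (disc n))"
    if "C \<in> ?\<C>" for C
    using that by fastforce
  have "topspace X = (\<Union>c\<in>K. open_cell c)"
    using K by (simp add: z2_cw_structure_def)
  also have "\<dots> \<subseteq> \<Union>?\<C>"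
  proof (intro UN_least subsetI)
    fix c x assume c: "c \<in> K" and x: "x \<in> open_cell c"
    obtain n b \<phi> where [simp]: "c = (n, b, \<phi>)" by (cases c)
    obtain s v where "s \<in> orbit_set b" "v \<in> topspace (disc n)" "x = \<phi> (s, v)"
      using x by (auto simp: open_cell_def disc_interior_def)
    then have "x \<in> \<phi> ` ({s} \<times> topspace (disc n))" by blast
    then show "x \<in> \<Union>?\<C>"
      using c \<open>s \<in> orbit_set b\<close> by (intro UnionI) auto
  qed
  finally have "topspace X \<subseteq> \<Union>?\<C>" .
  show thesis
  proof
    have "finite (orbit_set b)" for b by (rule finite_subset[OF subset_UNIV]) simp
    then show "finite ?\<C>" using K(1) by (intro finite_UN_I) (auto split: prod.split)
    have co: "compactin X C" if "C \<in> ?\<C>" for C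
      using img[OF that] comp cont image_compactin by metis
    moreover have "connectedin X C" if "C \<in> ?\<C>" for C
      using img[OF that] conn cont connectedin_continuous_map_image by metis
    ultimately show "\<forall>C\<in>?\<C>. compactin X C \<and> connectedin X C" by blast
    show "topspace X = \<Union>?\<C>"
      using \<open>topspace X \<subseteq> \<Union>?\<C>\<close> co compactin_subset_topspace by blast
  qed
qed

lemma finite_z2_cw_complex_compact:
  assumes "finite_z2_cw_complex X \<tau>"
  shows "compact_space X"
proof -
  obtain \<C> where "finite \<C>" "\<forall>C\<in>\<C>. compactin X C \<and> connectedin X C" "topspace X = \<Union>\<C>"
    by (rule finite_z2_cw_complex_cover[OF assms])
  then show ?thesis
    by (simp add: compact_space_def compactin_Union)
qed

text \<open>A connected member of the cover lies in one component, namely that of any chosen point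
  of it. Hence there are at most as many components as members.\<close>

lemma finite_connected_components_of_cover:
  assumes "finite \<C>" and conn: "\<forall>C\<in>\<C>. connectedin X C" and cover: "topspace X = \<Union>\<C>"
  shows "finite (connected_components_of X)"
proof -
  have "connected_component_of_set X x \<in> (\<lambda>C. connected_component_of_set X (SOME y. y \<in> C)) ` \<C>"
    if x: "x \<in> topspace X" for x
  proof -
    obtain C where C: "C \<in> \<C>" "x \<in> C" using x cover by blast
    then have "(SOME y. y \<in> C) \<in> C" by (auto intro: someI)
    then have "connected_component_of X x (SOME y. y \<in> C)"
      using C conn by (auto simp: connected_component_of_def)
    then show ?thesis
      using C by (metis connected_component_of_equiv image_eqI)
  qed
  then have "connected_components_of X \<subseteq> (\<lambda>C. connected_component_of_set X (SOME y. y \<in> C)) ` \<C>"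
    by (auto simp: connected_components_of_def)
  then show ?thesis
    by (rule finite_surj[OF \<open>finite \<C>\<close>])
qed

lemma finite_z2_cw_complex_finite_components:
  assumes "finite_z2_cw_complex X \<tau>"
  shows "finite (connected_components_of X)"
proof -
  obtain \<C> where "finite \<C>" "\<forall>C\<in>\<C>. compactin X C \<and> connectedin X C" "topspace X = \<Union>\<C>"
    by (rule finite_z2_cw_complex_cover[OF assms])
  then show ?thesis
    by (intro finite_connected_components_of_cover[of \<C>]) auto
qed

text \<open>Two distinct components swapped by \<open>\<tau>\<close> can be sent to the constants 1
  and -1, so only invariant components need a given map. Finiteness makes components open, hence the
  pieces glue continuously.\<close>

lemma z2_map_from_invariant_components:
  assumes z2: "z2_space X \<tau>" and fin: "finite (connected_components_of X)"
    and inv: "\<And>C. C \<in> connected_components_of X \<Longrightarrow> \<tau> ` C = C \<Longrightarrow>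
      \<exists>g. z2_map (subtopology X C) \<tau> circle uminus g"
  shows "\<exists>g. z2_map X \<tau> circle uminus g"
proof -
  have inv2: "\<tau> (\<tau> x) = x" and top: "\<tau> x \<in> topspace X" if "x \<in> topspace X" for x
    using z2 that by (auto simp: z2_space_def continuous_map_def)
  have hom: "homeomorphic_map X X \<tau>"
    unfolding homeomorphic_map_maps homeomorphic_maps_def
    using z2 by (intro exI[of _ \<tau>]) (simp add: z2_space_def)
  let ?P = "connected_components_of X"
  have sub: "C \<subseteq> topspace X" if "C \<in> ?P" for C
    using that Union_connected_components_of[of X] by blast
  have im: "\<tau> ` C \<in> ?P" if "C \<in> ?P" for C
    using homeomorphic_map_connected_components_of[OF hom] that by blast
  have imim: "\<tau> ` (\<tau> ` C) = C" if "C \<in> ?P" for C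
  proof -
    have "\<tau> ` (\<tau> ` C) = id ` C"
      unfolding image_image using sub[OF that] inv2 by (intro image_cong) auto
    then show ?thesis by simp
  qed
  define G where "G C = (SOME g. z2_map (subtopology X C) \<tau> circle uminus g)" for C
  have G: "z2_map (subtopology X C) \<tau> circle uminus (G C)" if "C \<in> ?P" "\<tau> ` C = C" for C
    unfolding G_def using inv[OF that] by (rule someI_ex)
  \<comment> \<open>\<open>SOME\<close> sees only the unordered pair \<open>{C, \<tau> ` C}\<close>, so it selects the same member from both ends.\<close>
  define s where "s C = (if C = (SOME D. D \<in> {C, \<tau> ` C}) then 1 else - 1 :: complex)" for C
  have s: "s (\<tau> ` C) = - s C" if "C \<in> ?P" "\<tau> ` C \<noteq> C" for C
  proof -
    have "(SOME D. D \<in> {C, \<tau> ` C}) \<in> {C, \<tau> ` C}" by (rule someI[of _ C]) auto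
    moreover have "{\<tau> ` C, \<tau> ` (\<tau> ` C)} = {C, \<tau> ` C}" using imim[OF that(1)] by auto
    ultimately show ?thesis using that(2) by (auto simp: s_def)
  qed
  define f where "f C = (if \<tau> ` C = C then G C else (\<lambda>_. s C))" for C
  obtain g where g: "continuous_map X circle g"
    and gf: "\<And>x C. C \<in> ?P \<Longrightarrow> x \<in> topspace X \<inter> C \<Longrightarrow> g x = f C x"
  proof (rule pasting_lemma_exists[of X "\<lambda>C. C" ?P circle f])
    show "topspace X \<subseteq> \<Union> ((\<lambda>C. C) ` ?P)" by (simp add: Union_connected_components_of)
    show "openin X C" if "C \<in> ?P" for C
      using fin that by (rule open_in_finite_connected_components)
    show "continuous_map (subtopology X C) circle (f C)" if "C \<in> ?P" for C
      using G[OF that] by (auto simp: f_def s_def z2_map_def)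
    show "f C x = f D x" if "C \<in> ?P" "D \<in> ?P" "x \<in> topspace X \<inter> C \<inter> D" for C D x
      using that connected_components_of_overlap[OF that(1,2)] by blast
  qed (erule that, blast)
  have "g (\<tau> x) = - g x" if x: "x \<in> topspace X" for x
  proof -
    obtain C where C: "C \<in> ?P" "x \<in> C" using x Union_connected_components_of[of X] by blast
    \<comment> \<open>The point \<open>\<tau> x\<close> lies in the image of \<open>C\<close> under
      \<open>\<tau>\<close>, so the piece belonging to that component computes \<open>g\<close>
      there.\<close>
    have "g (\<tau> x) = f (\<tau> ` C) (\<tau> x)"
      using C im x top by (intro gf) auto
    also have "\<dots> = - f C x"
    proof (cases "\<tau> ` C = C")
      case True
      then show ?thesis using G[OF C(1) True] C x by (simp add: f_def z2_map_def)
    next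
      case False
      then show ?thesis using s[OF C(1) False] imim[OF C(1)] by (auto simp: f_def)
    qed
    also have "f C x = g x" using C x by (intro gf[symmetric]) auto
    finally show ?thesis .
  qed
  with g show ?thesis by (auto simp: z2_map_def)
qed

subsection \<open>Logarithms of maps from a product to the circle\<close>

text \<open>A bridge from type-class continuity of an operation, such as complex multiplication, to
  continuity of its values along maps on an abstract topology.\<close>

lemma continuous_map_binop:
  fixes f :: "'a \<Rightarrow> 'b::topological_space" and g :: "'a \<Rightarrow> 'c::topological_space"
    and h :: "'b \<Rightarrow> 'c \<Rightarrow> 'd::topological_space"
  assumes "continuous_map T euclidean f" "continuous_map T euclidean g"
    and "continuous_on UNIV (\<lambda>p. h (fst p) (snd p))"
  shows "continuous_map T euclidean (\<lambda>t. h (f t) (g t))"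
proof -
  have "continuous_map T euclidean (\<lambda>t. (f t, g t))"
    unfolding prod_topology_euclidean[symmetric] by (rule continuous_map_pairedI[OF assms(1,2)])
  from continuous_map_compose[OF this, of euclidean "\<lambda>p. h (fst p) (snd p)"] assms(3)
   show ?thesis by (simp add: o_def)
qed

lemma cis_Im_Ln: "norm z = 1 \<Longrightarrow> cis (Im (Ln z)) = z"
  by (metis Arg_eq_Im_Ln cis_Arg norm_zero sgn_eq zero_neq_one of_real_1 div_by_1)

text \<open>The open right half-plane avoids the branch cut of \<open>Ln\<close> along the
  nonpositive reals.\<close>

lemma continuous_map_Im_Ln:
  assumes "continuous_map T euclidean f" and "\<And>t. t \<in> topspace T \<Longrightarrow> Re (f t) > 0"
  shows "continuous_map T euclideanreal (\<lambda>t. Im (Ln (f t)))"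
proof -
  have "continuous_map T (top_of_set {z. Re z > 0}) f"
    using assms by (auto simp: continuous_map_in_subtopology)
  moreover have "continuous_map (top_of_set {z. Re z > 0}) euclideanreal (\<lambda>z. Im (Ln z))"
    by (auto intro!: continuous_intros simp: complex_nonpos_Reals_iff)
  ultimately have "continuous_map T euclideanreal ((\<lambda>z. Im (Ln z)) \<circ> f)"
    by (rule continuous_map_compose)
  then show ?thesis by (simp add: o_def)
qed

text \<open>The image of \<open>d\<close> is a connected and countable set of reals, hence has at
  most one point.\<close>

lemma cis_eq_1_constant:
  assumes Y: "connected_space Y" and d: "continuous_map Y euclideanreal d"
    and cis: "\<And>y. y \<in> topspace Y \<Longrightarrow> cis (d y) = 1"
  shows "\<exists>m::int. \<forall>y\<in>topspace Y. d y = 2 * pi * m"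
proof (cases "topspace Y = {}")
  case False
  have *: "\<exists>m::int. d y = 2 * pi * m" if "y \<in> topspace Y" for y
  proof -
    have "exp (\<i> * d y) = 1" using cis[OF that] by (simp add: cis_conv_exp)
    then show ?thesis by (auto simp: exp_eq_1 mult_ac)
  qed
  then have "d ` topspace Y \<subseteq> range (\<lambda>m::int. 2 * pi * m)" by blast
  then have "countable (d ` topspace Y)"
    by (rule countable_subset) simp
  moreover have "connected (d ` topspace Y)"
    using connectedin_continuous_map_image[OF d] Y by (auto simp: connectedin_topspace)
  ultimately have "d y = d y'" if "y \<in> topspace Y" "y' \<in> topspace Y" for y y'
    using connected_uncountable[of "d ` topspace Y" "d y" "d y'"] that by blast
  moreover obtain y0 where y0: "y0 \<in> topspace Y" using False by blast
  ultimately show ?thesis using *[OF y0] by metis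
qed auto

text \<open>The difference of two logarithms is a constant multiple of \<open>2 * pi\<close>, and it
  vanishes at \<open>y0\<close>.\<close>

lemma circle_log_unique:
  assumes Y: "connected_space Y" and "continuous_map Y euclideanreal \<theta>" "continuous_map Y euclideanreal \<theta>'"
    and cis: "\<And>y. y \<in> topspace Y \<Longrightarrow> cis (\<theta> y) = cis (\<theta>' y)"
    and y0: "y0 \<in> topspace Y" "\<theta> y0 = \<theta>' y0" and y: "y \<in> topspace Y"
  shows "\<theta> y = \<theta>' y"
proof -
  have "continuous_map Y euclideanreal (\<lambda>y. \<theta> y - \<theta>' y)"
    using assms by (intro continuous_intros)
  moreover have "cis (\<theta> y - \<theta>' y) = 1" if "y \<in> topspace Y" for y
    using cis[OF that] by (simp flip: cis_divide)
  ultimately obtain m :: int where "\<forall>y\<in>topspace Y. \<theta> y - \<theta>' y = 2 * pi * m"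
    using cis_eq_1_constant[OF Y] by blast
  then have "\<theta> y - \<theta>' y = \<theta> y0 - \<theta>' y0" using y0(1) y by metis
  then show ?thesis using y0(2) by simp
qed

text \<open>Compactness of \<open>Y\<close> makes nearby slices \<open>F (x, _)\<close> differ by a uniformly small rotation, so
  a logarithm of one slice yields one of the other. The slices with a logarithm thus form a clopen
  set of parameters.\<close>

lemma circle_log_prod:
  fixes F :: "'a \<times> 'b \<Rightarrow> complex"
  assumes X: "connected_space X" and Y: "connected_space Y" "compact_space Y"
    and F: "continuous_map (prod_topology X Y) euclidean F"
    and norm: "\<And>x y. x \<in> topspace X \<Longrightarrow> y \<in> topspace Y \<Longrightarrow> norm (F (x, y)) = 1"
    and x0: "x0 \<in> topspace X" "\<And>y. y \<in> topspace Y \<Longrightarrow> F (x0, y) = 1"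
    and y0: "y0 \<in> topspace Y" "\<And>x. x \<in> topspace X \<Longrightarrow> F (x, y0) = 1"
  obtains \<theta> where "continuous_map (prod_topology X Y) euclideanreal \<theta>"
    "\<forall>x\<in>topspace X. \<forall>y\<in>topspace Y. cis (\<theta> (x, y)) = F (x, y)"
proof -
  have slice1: "continuous_map Y euclidean (\<lambda>y. F (x, y))" if "x \<in> topspace X" for x
    using that continuous_map_compose[OF _ F, of Y "\<lambda>y. (x, y)"]
    by (simp add: continuous_map_pairedI o_def)
  have slice2: "continuous_map (prod_topology X Y) euclidean (\<lambda>p. F (x, snd p))" if "x \<in> topspace X" for x
    using that continuous_map_compose[OF _ F, of "prod_topology X Y" "\<lambda>p. (x, snd p)"]
    by (simp add: continuous_map_pairedI continuous_map_snd o_def)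
  have mult: "continuous_on UNIV (\<lambda>p::complex \<times> complex. fst p * cnj (snd p))"
    by (intro continuous_intros)
  \<comment> \<open>For unit complex numbers \<open>cnj\<close> is the inverse, so this asks that
    the quotient of the two slices stay in the right half-plane, where \<open>Ln\<close> is
    continuous.\<close>
  define near where "near x x' \<longleftrightarrow> (\<forall>y\<in>topspace Y. Re (F (x', y) * cnj (F (x, y))) > 0)" for x x'
  have near_sym: "near x x' \<longleftrightarrow> near x' x" for x x'
    by (auto simp: near_def mult.commute)
  have "\<exists>U. openin X U \<and> x \<in> U \<and> (\<forall>x'\<in>U. near x x')" if x: "x \<in> topspace X" for x
  proof -
    let ?q = "\<lambda>p. Re (F p * cnj (F (x, snd p)))"
    let ?W = "{p \<in> topspace (prod_topology X Y). ?q p \<in> {0<..}}"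
    have "continuous_map (prod_topology X Y) euclidean (\<lambda>p. F p * cnj (F (x, snd p)))"
      by (rule continuous_map_binop[OF F slice2[OF x] mult])
    from continuous_map_compose[OF this, of euclideanreal Re]
    have "continuous_map (prod_topology X Y) euclideanreal ?q"
      by (simp add: o_def continuous_on_Re)
    then have W: "openin (prod_topology X Y) ?W"
      by (rule openin_continuous_map_preimage) auto
    have sub: "{x} \<times> topspace Y \<subseteq> ?W"
    proof -
      have "F (x, y) * cnj (F (x, y)) = 1" if "y \<in> topspace Y" for y
        using norm[OF x that] by (simp flip: complex_norm_square)
      then have "0 < ?q (x, y)" if "y \<in> topspace Y" for y
        using that by (simp only: snd_conv) simp
      then show ?thesis using x by auto
    qed
    have "compactin X {x}" "compactin Y (topspace Y)"
      using x Y(2) by (simp_all add: compact_space_def)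
    \<comment> \<open>Tube lemma: the open set \<open>?W\<close> contains the compact slice over
      \<open>x\<close>, hence a whole tube around it.\<close>
    from Wallace_theorem_prod_topology[OF this W sub] obtain U V where
      UV: "openin X U" "openin Y V" "{x} \<subseteq> U" "topspace Y \<subseteq> V" "U \<times> V \<subseteq> ?W" .
    have "near x x'" if "x' \<in> U" for x'
      unfolding near_def
    proof
      fix y assume "y \<in> topspace Y"
      then have "(x', y) \<in> ?W" using UV that by blast
      then show "Re (F (x', y) * cnj (F (x, y))) > 0" by simp
    qed
    then show ?thesis using UV by blast
  qed
  then obtain U where U: "\<And>x. x \<in> topspace X \<Longrightarrow> openin X (U x)" "\<And>x. x \<in> topspace X \<Longrightarrow> x \<in> U x"
      "\<And>x x'. x \<in> topspace X \<Longrightarrow> x' \<in> U x \<Longrightarrow> near x x'"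
    by metis
  have UX: "x' \<in> topspace X" if "x \<in> topspace X" "x' \<in> U x" for x x'
    using U(1) that openin_subset by blast
  \<comment> \<open>The normalisation at \<open>y0\<close>, consistent because \<open>F\<close> is 1
    there, singles out one logarithm per slice.\<close>
  define is_log where "is_log x \<theta> \<longleftrightarrow> continuous_map Y euclideanreal \<theta> \<and> \<theta> y0 = 0 \<and>
    (\<forall>y\<in>topspace Y. cis (\<theta> y) = F (x, y))" for x \<theta>
  \<comment> \<open>The angle from the slice over \<open>x\<close> to the value of \<open>F\<close>
    at \<open>p\<close>; it is 0 over \<open>y0\<close>.\<close>
  define step where "step x p = Im (Ln (F p * cnj (F (x, snd p))))" for x p
  have log_step: "is_log x' (\<lambda>y. \<theta> y + step x (x', y))"
    if "is_log x \<theta>" "near x x'" "x \<in> topspace X" "x' \<in> topspace X" for x x' \<theta>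
  proof -
    have "continuous_map Y euclidean (\<lambda>y. F (x', y) * cnj (F (x, y)))"
      using that by (intro continuous_map_binop[OF _ _ mult] slice1)
    then have "continuous_map Y euclideanreal (\<lambda>y. step x (x', y))"
      using that by (auto simp: step_def near_def intro!: continuous_map_Im_Ln)
    moreover have "cis (\<theta> y + step x (x', y)) = F (x', y)" if y: "y \<in> topspace Y" for y
    proof -
      have "cis (step x (x', y)) = F (x', y) * cnj (F (x, y))"
        using norm that \<open>x \<in> topspace X\<close> \<open>x' \<in> topspace X\<close> y
        by (simp add: step_def cis_Im_Ln norm_mult)
      moreover have "F (x, y) * cnj (F (x, y)) = 1"
        using norm \<open>x \<in> topspace X\<close> y by (simp flip: complex_norm_square)
      ultimately show ?thesis
        using \<open>is_log x \<theta>\<close> y by (simp add: is_log_def mult_ac flip: cis_mult)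
    qed
    ultimately show ?thesis
      using that y0 by (auto simp: is_log_def step_def intro: continuous_intros)
  qed
  define S where "S = {x \<in> topspace X. \<exists>\<theta>. is_log x \<theta>}"
  have "openin X S"
  proof (subst openin_subopen, intro ballI exI conjI)
    fix x assume "x \<in> S"
    then obtain \<theta> where x: "x \<in> topspace X" "is_log x \<theta>" by (auto simp: S_def)
    show "openin X (U x)" "x \<in> U x" using U x by auto
    show "U x \<subseteq> S" using log_step[OF x(2) U(3)[OF x(1)] x(1)] UX[OF x(1)] by (auto simp: S_def)
  qed
  moreover have "openin X (topspace X - S)"
  proof (subst openin_subopen, intro ballI exI conjI)
    fix x assume x: "x \<in> topspace X - S"
    then show "openin X (U x)" "x \<in> U x" using U by auto
    \<comment> \<open>Nearness is symmetric, so a logarithm over \<open>x'\<close> would be carried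
      back to one over \<open>x\<close>.\<close>
    have False if "x' \<in> U x" "x' \<in> S" for x'
    proof -
      have "near x' x" using U(3) x that near_sym by blast
      then show False using that x log_step by (auto simp: S_def)
    qed
    then show "U x \<subseteq> topspace X - S" using UX x by blast
  qed
  moreover have "is_log x0 (\<lambda>_. 0)"
    using x0 by (simp add: is_log_def)
  then have "x0 \<in> S" using x0 by (auto simp: S_def)
  ultimately have "S = topspace X"
    using X unfolding connected_space_clopen_in closedin_def S_def by blast
  then have "\<forall>x\<in>topspace X. \<exists>\<theta>. is_log x \<theta>" unfolding S_def by blast
  then obtain \<theta> where \<theta>: "\<And>x. x \<in> topspace X \<Longrightarrow> is_log x (\<theta> x)"
    by metis
  \<comment> \<open>Both sides are logarithms of the slice over \<open>x'\<close> vanishing at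
    \<open>y0\<close>, so uniqueness applies.\<close>
  have \<theta>_step: "\<theta> x' y = \<theta> x y + step x (x', y)"
    if "x \<in> topspace X" "x' \<in> U x" "y \<in> topspace Y" for x x' y
  proof -
    have "is_log x' (\<lambda>y. \<theta> x y + step x (x', y))"
      using that U UX \<theta> log_step by blast
    then show ?thesis
      using \<theta>[OF UX[OF that(1,2)]] that(3) y0(1)
        circle_log_unique[OF Y(1), of "\<theta> x'" "\<lambda>y. \<theta> x y + step x (x', y)" y0 y]
      by (simp add: is_log_def)
  qed
  \<comment> \<open>The logarithms were chosen slice by slice, with no control in \<open>x\<close>.
    Near each fixed \<open>x\<close>, however, \<open>\<theta>_step\<close> gives a formula that is
    jointly continuous.\<close>
  have "continuous_map (prod_topology X Y) euclideanreal (\<lambda>(x, y). \<theta> x y)"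
  proof (rule pasting_lemma[of "topspace X" _ "\<lambda>x. U x \<times> topspace Y" _ "\<lambda>x p. \<theta> x (snd p) + step x p"])
    fix x assume x: "x \<in> topspace X"
    show "openin (prod_topology X Y) (U x \<times> topspace Y)"
      using U x by (simp add: openin_prod_Times_iff)
    let ?T = "subtopology (prod_topology X Y) (U x \<times> topspace Y)"
    have "continuous_map (prod_topology X Y) euclidean (\<lambda>p. F p * cnj (F (x, snd p)))"
      by (rule continuous_map_binop[OF F slice2[OF x] mult])
    then have "continuous_map ?T euclideanreal (step x)"
      unfolding step_def using U(3)[OF x]
      by (intro continuous_map_Im_Ln continuous_map_from_subtopology) (auto simp: near_def)
    moreover have "continuous_map ?T euclideanreal (\<lambda>p. \<theta> x (snd p))"
      using continuous_map_compose[OF continuous_map_snd, of Y euclideanreal "\<theta> x" X] \<theta>[OF x]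
      by (intro continuous_map_from_subtopology) (simp add: is_log_def o_def)
    ultimately show "continuous_map ?T euclideanreal (\<lambda>p. \<theta> x (snd p) + step x p)"
      by (intro continuous_intros)
  next
    fix x x' p
    assume "x \<in> topspace X" "x' \<in> topspace X"
      "p \<in> topspace (prod_topology X Y) \<inter> (U x \<times> topspace Y) \<inter> (U x' \<times> topspace Y)"
    then show "\<theta> x (snd p) + step x p = \<theta> x' (snd p) + step x' p"
      using \<theta>_step[symmetric] by (cases p) auto
  next
    fix p assume "p \<in> topspace (prod_topology X Y)"
    then show "\<exists>j. j \<in> topspace X \<and> p \<in> U j \<times> topspace Y \<and>
        (case p of (x, y) \<Rightarrow> \<theta> x y) = \<theta> j (snd p) + step j p"
      using \<theta>_step[of "fst p" "fst p" "snd p"] U(2) by (intro exI[of _ "fst p"]) auto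
  qed
  then show thesis
    using \<theta> by (intro that[of "\<lambda>(x, y). \<theta> x y"]) (auto simp: is_log_def)
qed

subsection \<open>The parity argument\<close>

text \<open>Using \<open>twist\<close> at \<open>x\<close> and at \<open>\<tau> x\<close> returns to
  \<open>a x\<close>, so the two angles add up to full turns. The map \<open>g\<close> rotates
  \<open>a\<close> by half the angle; under \<open>\<tau>\<close> it picks up the factor
  \<open>cis (pi * m)\<close>, which is -1 for odd \<open>m\<close>.\<close>

lemma z2_map_half_twist:
  assumes X: "z2_space X \<tau>" "connected_space X"
    and a: "continuous_map X euclidean a" "\<And>x. x \<in> topspace X \<Longrightarrow> norm (a x) = 1"
    and \<alpha>: "continuous_map X euclideanreal \<alpha>"
    and twist: "\<And>x. x \<in> topspace X \<Longrightarrow> a (\<tau> x) = a x * cis (\<alpha> x)"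
  obtains m :: int where "\<forall>x\<in>topspace X. \<alpha> x + \<alpha> (\<tau> x) = 2 * pi * m"
    "odd m \<longrightarrow> (\<exists>g. z2_map X \<tau> circle uminus g)"
proof -
  have \<tau>: "continuous_map X X \<tau>" "\<And>x. x \<in> topspace X \<Longrightarrow> \<tau> x \<in> topspace X"
      "\<And>x. x \<in> topspace X \<Longrightarrow> \<tau> (\<tau> x) = x"
    using X by (auto simp: z2_space_def continuous_map_def)
  have "continuous_map X euclideanreal (\<lambda>x. \<alpha> (\<tau> x))"
    using continuous_map_compose[OF \<tau>(1) \<alpha>] by (simp add: o_def)
  then have "continuous_map X euclideanreal (\<lambda>x. \<alpha> x + \<alpha> (\<tau> x))"
    by (intro continuous_map_add \<alpha>)
  moreover have "cis (\<alpha> x + \<alpha> (\<tau> x)) = 1" if x: "x \<in> topspace X" for x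
  proof -
    have "a x = a x * (cis (\<alpha> x) * cis (\<alpha> (\<tau> x)))"
      using twist[OF x] twist[OF \<tau>(2)[OF x]] \<tau>(3)[OF x] by (simp add: mult.assoc)
    moreover have "a x \<noteq> 0" using a(2)[OF x] by auto
    ultimately show ?thesis by (simp add: cis_mult)
  qed
  ultimately obtain m :: int where m: "\<forall>x\<in>topspace X. \<alpha> x + \<alpha> (\<tau> x) = 2 * pi * m"
    using cis_eq_1_constant[OF X(2)] by blast
  have "\<exists>g. z2_map X \<tau> circle uminus g" if "odd m"
  proof -
    define g where "g x = a x * cis (\<alpha> x / 2)" for x
    have "continuous_map X euclidean g"
      unfolding g_def
      by (intro continuous_map_binop[OF a(1) \<alpha>, of "\<lambda>z t. z * cis (t / 2)"] continuous_intros) auto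
    moreover have "norm (g x) = 1" if "x \<in> topspace X" for x
      using a(2)[OF that] by (simp add: g_def norm_mult)
    ultimately have "continuous_map X circle g"
      by (auto simp: continuous_map_in_subtopology)
    moreover have "g (\<tau> x) = - g x" if x: "x \<in> topspace X" for x
    proof -
      have "\<alpha> (\<tau> x) = 2 * pi * m - \<alpha> x" using m x by (simp add: algebra_simps)
      then have e: "\<alpha> x + \<alpha> (\<tau> x) / 2 = \<alpha> x / 2 + pi * m" by (simp add: field_simps)
      have "cis (pi * m) = - 1"
        using \<open>odd m\<close> by (simp add: complex_eq_iff cos_int_times_real sin_int_times_real mult.commute)
      then have "cis (\<alpha> x + \<alpha> (\<tau> x) / 2) = - cis (\<alpha> x / 2)"
        unfolding e cis_mult[symmetric] by simp
      then show ?thesis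
        by (simp add: g_def twist[OF x] mult.assoc cis_mult)
    qed
    ultimately show ?thesis by (auto simp: z2_map_def)
  qed
  then show thesis using m that by blast
qed

lemma z2_map_factor_connected:
  assumes X: "z2_space X \<tau>" "connected_space X"
    and Y: "z2_space Y \<sigma>" "connected_space Y" "compact_space Y"
    and f: "z2_map (prod_topology X Y) (map_prod \<tau> \<sigma>) circle uminus f"
    and x0: "x0 \<in> topspace X" and y0: "y0 \<in> topspace Y"
  shows "(\<exists>g. z2_map X \<tau> circle uminus g) \<or> (\<exists>h. z2_map Y \<sigma> circle uminus h)"
proof -
  let ?XY = "prod_topology X Y"
  have \<tau>: "continuous_map X X \<tau>" "\<And>x. x \<in> topspace X \<Longrightarrow> \<tau> x \<in> topspace X"
      "\<And>x. x \<in> topspace X \<Longrightarrow> \<tau> (\<tau> x) = x"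
    and \<sigma>: "continuous_map Y Y \<sigma>" "\<And>y. y \<in> topspace Y \<Longrightarrow> \<sigma> y \<in> topspace Y"
      "\<And>y. y \<in> topspace Y \<Longrightarrow> \<sigma> (\<sigma> y) = y"
    using X Y by (auto simp: z2_space_def continuous_map_def)
  have fc: "continuous_map ?XY euclidean f"
    and fn: "\<And>x y. x \<in> topspace X \<Longrightarrow> y \<in> topspace Y \<Longrightarrow> norm (f (x, y)) = 1"
    and fe: "\<And>x y. x \<in> topspace X \<Longrightarrow> y \<in> topspace Y \<Longrightarrow> f (\<tau> x, \<sigma> y) = - f (x, y)"
    using f by (auto simp: z2_map_def continuous_map_in_subtopology)
  define a where "a x = f (x, y0)" for x
  define b where "b y = f (x0, y)" for y
  define c where "c = f (x0, y0)"
  have sliceX: "continuous_map X euclidean (\<lambda>x. \<phi> (t x, y))"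
    if "continuous_map ?XY euclidean \<phi>" "continuous_map X X t" "y \<in> topspace Y"
    for y t and \<phi> :: "'a \<times> 'b \<Rightarrow> 'c::topological_space"
    using that continuous_map_compose[OF _ that(1), of X "\<lambda>x. (t x, y)"]
    by (simp add: continuous_map_pairedI o_def)
  have sliceY: "continuous_map Y euclidean (\<lambda>y. \<phi> (x, t y))"
    if "continuous_map ?XY euclidean \<phi>" "continuous_map Y Y t" "x \<in> topspace X"
    for x t and \<phi> :: "'a \<times> 'b \<Rightarrow> 'c::topological_space"
    using that continuous_map_compose[OF _ that(1), of Y "\<lambda>y. (x, t y)"]
    by (simp add: continuous_map_pairedI o_def)
  have a: "continuous_map X euclidean a" and b: "continuous_map Y euclidean b"
    using sliceX[OF fc continuous_map_id y0] sliceY[OF fc continuous_map_id x0]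
    by (simp_all add: a_def[abs_def] b_def[abs_def])
  have an: "norm (a x) = 1" if "x \<in> topspace X" for x using fn that y0 by (simp add: a_def)
  have bn: "norm (b y) = 1" if "y \<in> topspace Y" for y using fn that x0 by (simp add: b_def)
  have cn: "norm c = 1" using fn x0 y0 by (simp add: c_def)
  have cnj: "z * cnj z = 1" if "norm z = 1" for z
    using that by (simp flip: complex_norm_square)
  \<comment> \<open>Since \<open>cnj\<close> inverts unit numbers, this is \<open>f\<close> divided
    by the product of its two restrictions, with \<open>c\<close> normalising it to be 1 on both
    axes through \<open>(x0, y0)\<close>, as \<open>circle_log_prod\<close> requires.\<close>
  define F where "F p = f p * (c * cnj (a (fst p) * b (snd p)))" for p
  have "continuous_map ?XY euclidean (\<lambda>p. a (fst p) * b (snd p))"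
    using continuous_map_compose[OF continuous_map_fst a, of Y]
      continuous_map_compose[OF continuous_map_snd b, of X]
    by (intro continuous_map_binop[of _ _ _ "(*)"]) (auto simp: o_def intro!: continuous_intros)
  then have Fc: "continuous_map ?XY euclidean F"
    unfolding F_def
    by (intro continuous_map_binop[OF fc, of _ "\<lambda>z w. z * (c * cnj w)"] continuous_intros) auto
  have Fn: "norm (F (x, y)) = 1" if "x \<in> topspace X" "y \<in> topspace Y" for x y
    using that an bn cn fn by (simp add: F_def norm_mult)
  have F1: "F (x0, y) = 1" if "y \<in> topspace Y" for y
  proof -
    have "F (x0, y) = (c * cnj c) * (b y * cnj (b y))"
      by (simp add: F_def a_def b_def c_def mult_ac)
    then show ?thesis using cnj[OF cn] cnj[OF bn[OF that]] by simp
  qed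
  have F2: "F (x, y0) = 1" if "x \<in> topspace X" for x
  proof -
    have "F (x, y0) = (c * cnj c) * (a x * cnj (a x))"
      by (simp add: F_def a_def b_def c_def mult_ac)
    then show ?thesis using cnj[OF cn] cnj[OF an[OF that]] by simp
  qed
  obtain \<theta> where \<theta>: "continuous_map ?XY euclideanreal \<theta>"
    and F\<theta>: "\<forall>x\<in>topspace X. \<forall>y\<in>topspace Y. cis (\<theta> (x, y)) = F (x, y)"
    by (rule circle_log_prod[OF X(2) Y(2,3) Fc Fn x0 F1 y0 F2])
  have split: "f (x, y) * c = a x * b y * cis (\<theta> (x, y))"
    if "x \<in> topspace X" "y \<in> topspace Y" for x y
  proof -
    have "a x * b y * cis (\<theta> (x, y)) = f (x, y) * c * (a x * cnj (a x)) * (b y * cnj (b y))"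
      using F\<theta> that by (simp add: F_def mult_ac)
    then show ?thesis using cnj[OF an[OF that(1)]] cnj[OF bn[OF that(2)]] by simp
  qed
  \<comment> \<open>This compares \<open>split\<close> at a point and at its image under the
    diagonal action; the minus sign is the antipodal map.\<close>
  have equi: "a (\<tau> x) * b (\<sigma> y) = - (a x * b y * cis (\<theta> (x, y) - \<theta> (\<tau> x, \<sigma> y)))"
    if "x \<in> topspace X" "y \<in> topspace Y" for x y
  proof -
    have "a (\<tau> x) * b (\<sigma> y) * cis (\<theta> (\<tau> x, \<sigma> y)) = - (a x * b y * cis (\<theta> (x, y)))"
      using split[OF that] split[OF \<tau>(2)[OF that(1)] \<sigma>(2)[OF that(2)]] fe[OF that] by simp
    then show ?thesis by (simp add: field_simps flip: cis_divide)
  qed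
  \<comment> \<open>The angles come from \<open>equi\<close> with \<open>y = y0\<close> and with
    \<open>x = x0\<close> respectively. The factor left after cancelling the fixed coordinate is a
    unit constant, and \<open>Arg\<close> turns it into an angle.\<close>
  define \<alpha> where "\<alpha> x = \<theta> (x, y0) - \<theta> (\<tau> x, \<sigma> y0) + Arg (- (b y0 * cnj (b (\<sigma> y0))))" for x
  define \<beta> where "\<beta> y = \<theta> (x0, y) - \<theta> (\<tau> x0, \<sigma> y) + Arg (- (a x0 * cnj (a (\<tau> x0))))" for y
  have cisArg: "cis (Arg z) = z" if "norm z = 1" for z
    using that by (metis cis_Arg norm_zero sgn_eq zero_neq_one of_real_1 div_by_1)
  have \<alpha>: "continuous_map X euclideanreal \<alpha>"
    unfolding \<alpha>_def
    using sliceX[OF \<theta> continuous_map_id y0] sliceX[OF \<theta> \<tau>(1) \<sigma>(2)[OF y0]]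
    by (intro continuous_intros) auto
  have \<beta>: "continuous_map Y euclideanreal \<beta>"
    unfolding \<beta>_def
    using sliceY[OF \<theta> continuous_map_id x0] sliceY[OF \<theta> \<sigma>(1) \<tau>(2)[OF x0]]
    by (intro continuous_intros) auto
  have a\<alpha>: "a (\<tau> x) = a x * cis (\<alpha> x)" if x: "x \<in> topspace X" for x
  proof -
    have "a (\<tau> x) = a (\<tau> x) * b (\<sigma> y0) * cnj (b (\<sigma> y0))"
      using cnj[OF bn[OF \<sigma>(2)[OF y0]]] by (simp add: mult.assoc)
    also have "\<dots> = a x * (cis (\<theta> (x, y0) - \<theta> (\<tau> x, \<sigma> y0)) * - (b y0 * cnj (b (\<sigma> y0))))"
      unfolding equi[OF x y0] by (simp add: mult_ac)
    also have "- (b y0 * cnj (b (\<sigma> y0))) = cis (Arg (- (b y0 * cnj (b (\<sigma> y0)))))"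
      using bn y0 \<sigma>(2) by (intro cisArg[symmetric]) (simp add: norm_mult)
    finally show ?thesis by (simp add: \<alpha>_def cis_mult)
  qed
  have b\<beta>: "b (\<sigma> y) = b y * cis (\<beta> y)" if y: "y \<in> topspace Y" for y
  proof -
    have "b (\<sigma> y) = a (\<tau> x0) * b (\<sigma> y) * cnj (a (\<tau> x0))"
      using cnj[OF an[OF \<tau>(2)[OF x0]]] by (simp add: mult_ac)
    also have "\<dots> = b y * (cis (\<theta> (x0, y) - \<theta> (\<tau> x0, \<sigma> y)) * - (a x0 * cnj (a (\<tau> x0))))"
      unfolding equi[OF x0 y] by (simp add: mult_ac)
    also have "- (a x0 * cnj (a (\<tau> x0))) = cis (Arg (- (a x0 * cnj (a (\<tau> x0)))))"
      using an x0 \<tau>(2) by (intro cisArg[symmetric]) (simp add: norm_mult)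
    finally show ?thesis by (simp add: \<beta>_def cis_mult)
  qed
  obtain m where m: "\<forall>x\<in>topspace X. \<alpha> x + \<alpha> (\<tau> x) = 2 * pi * of_int m"
    and mg: "odd m \<longrightarrow> (\<exists>g. z2_map X \<tau> circle uminus g)"
    by (rule z2_map_half_twist[OF X a an \<alpha> a\<alpha>])
  obtain n where n: "\<forall>y\<in>topspace Y. \<beta> y + \<beta> (\<sigma> y) = 2 * pi * of_int n"
    and nh: "odd n \<longrightarrow> (\<exists>h. z2_map Y \<sigma> circle uminus h)"
    by (rule z2_map_half_twist[OF Y(1,2) b bn \<beta> b\<beta>])
  \<comment> \<open>The rotation from \<open>a x * b y\<close> to
    \<open>a (\<tau> x) * b (\<sigma> y)\<close> has two descriptions: the angle
    \<open>\<alpha> x + \<beta> y\<close>, and by \<open>equi\<close> the difference of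
    \<open>\<theta>\<close> values plus \<open>pi\<close> for the sign. Their discrepancy
    \<open>\<delta>\<close> is thus a multiple of \<open>2 * pi\<close>, constant by
    connectedness.\<close>
  define \<delta> where "\<delta> p = \<alpha> (fst p) + \<beta> (snd p) - \<theta> p + \<theta> (map_prod \<tau> \<sigma> p) - pi" for p
  have "continuous_map ?XY euclideanreal \<delta>"
  proof -
    have "continuous_map ?XY ?XY (map_prod \<tau> \<sigma>)"
      using f continuous_map_compose[OF continuous_map_fst \<tau>(1), of Y]
        continuous_map_compose[OF continuous_map_snd \<sigma>(1), of X]
      by (auto simp: map_prod_def split_def o_def intro: continuous_map_pairedI)
    from continuous_map_compose[OF this \<theta>] continuous_map_compose[OF continuous_map_fst \<alpha>, of Y]
      continuous_map_compose[OF continuous_map_snd \<beta>, of X] \<theta>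
    show ?thesis unfolding \<delta>_def by (intro continuous_intros) (auto simp: o_def)
  qed
  moreover have "cis (\<delta> p) = 1" if p: "p \<in> topspace ?XY" for p
  proof -
    obtain x y where xy: "p = (x, y)" "x \<in> topspace X" "y \<in> topspace Y" using p by auto
    have "a x * b y * cis (\<alpha> x + \<beta> y) = a x * b y * - cis (\<theta> (x, y) - \<theta> (\<tau> x, \<sigma> y))"
      using equi[OF xy(2,3)] a\<alpha>[OF xy(2)] b\<beta>[OF xy(3)] by (simp add: mult_ac flip: cis_mult)
    moreover have "a x * b y \<noteq> 0" using an[OF xy(2)] bn[OF xy(3)] by auto
    ultimately have "cis (\<alpha> x + \<beta> y) = - cis (\<theta> (x, y) - \<theta> (\<tau> x, \<sigma> y))"
      by (metis mult_cancel_left)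
    moreover have "\<delta> p = (\<alpha> x + \<beta> y) - (\<theta> (x, y) - \<theta> (\<tau> x, \<sigma> y)) - pi"
      by (simp add: \<delta>_def xy)
    ultimately show ?thesis by (simp flip: cis_divide)
  qed
  moreover have "connected_space ?XY"
    using X(2) Y(2) by (simp add: connected_space_prod_topology)
  ultimately obtain k :: int where k: "\<forall>p\<in>topspace ?XY. \<delta> p = 2 * pi * k"
    using cis_eq_1_constant by blast
  \<comment> \<open>Adding \<open>\<delta>\<close> at a point and at its image cancels every
    \<open>\<theta>\<close> term, because the action is an involution. The two copies of
    \<open>pi\<close> survive and make \<open>m + n\<close> odd.\<close>
  have "\<delta> (x0, y0) + \<delta> (\<tau> x0, \<sigma> y0) = 2 * pi * m + 2 * pi * n - 2 * pi"
    using m[rule_format, OF x0] n[rule_format, OF y0] \<tau>(3)[OF x0] \<sigma>(3)[OF y0]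
    by (simp add: \<delta>_def)
  moreover have "\<delta> (x0, y0) = 2 * pi * k" "\<delta> (\<tau> x0, \<sigma> y0) = 2 * pi * k"
    using k x0 y0 \<tau>(2) \<sigma>(2) by auto
  ultimately have "2 * pi * (m + n - 1 - 2 * k) = 0"
    by (simp add: algebra_simps)
  then have "real_of_int (m + n - 1 - 2 * k) = 0" by simp
  then have "m + n = 2 * k + 1" by linarith
  then have "odd m \<or> odd n" by presburger
  with mg nh show ?thesis by blast
qed

section \<open>Reduction to invariant components\<close>

lemma z2_space_invariant_component:
  assumes "z2_space X \<tau>" "\<tau> ` C = C" "C \<subseteq> topspace X"
  shows "z2_space (subtopology X C) \<tau>"
proof -
  have "continuous_map (subtopology X C) (subtopology X C) \<tau>"
    using assms
    by (auto simp: z2_space_def continuous_map_in_subtopology intro: continuous_map_from_subtopology)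
  then show ?thesis using assms by (auto simp: z2_space_def)
qed

theorem corollary1p4:
  fixes X :: "'a topology" and \<tau> :: "'a \<Rightarrow> 'a"
    and Y :: "'b topology" and \<sigma> :: "'b \<Rightarrow> 'b"
  assumes "finite_z2_cw_complex X \<tau>"
    and "finite_z2_cw_complex Y \<sigma>"
    and "\<exists>f. z2_map (prod_topology X Y) (map_prod \<tau> \<sigma>) circle uminus f"
  shows "(\<exists>g. z2_map X \<tau> circle uminus g) \<or> (\<exists>h. z2_map Y \<sigma> circle uminus h)"
proof (rule ccontr)
  assume neg: "\<not> ?thesis"
  have z2: "z2_space X \<tau>" "z2_space Y \<sigma>"
    using assms(1,2) by (auto simp: finite_z2_cw_complex_def z2_cw_structure_def)
  \<comment> \<open>If every invariant component mapped equivariantly to the circle, gluing would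
    give a map on all of \<open>X\<close>; so some invariant \<open>C\<close> admits none. The same
    holds for \<open>Y\<close> and \<open>D\<close>.\<close>
  obtain C where C: "C \<in> connected_components_of X" "\<tau> ` C = C"
    and noC: "\<not> (\<exists>g. z2_map (subtopology X C) \<tau> circle uminus g)"
    using z2_map_from_invariant_components[OF z2(1)
        finite_z2_cw_complex_finite_components[OF assms(1)]] neg by blast
  obtain D where D: "D \<in> connected_components_of Y" "\<sigma> ` D = D"
    and noD: "\<not> (\<exists>h. z2_map (subtopology Y D) \<sigma> circle uminus h)"
    using z2_map_from_invariant_components[OF z2(2)
        finite_z2_cw_complex_finite_components[OF assms(2)]] neg by blast
  obtain f where f: "z2_map (prod_topology X Y) (map_prod \<tau> \<sigma>) circle uminus f"
    using assms(3) by blast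
  have sub: "C \<subseteq> topspace X" "D \<subseteq> topspace Y"
    using C D Union_connected_components_of[of X] Union_connected_components_of[of Y] by auto
  obtain x0 y0 where "x0 \<in> C" "y0 \<in> D"
    using nonempty_connected_components_of[OF C(1)] nonempty_connected_components_of[OF D(1)] by blast
  \<comment> \<open>The map \<open>f\<close> restricts to the product of the two bad components,
    where the connected case contradicts their choice.\<close>
  have "z2_map (prod_topology (subtopology X C) (subtopology Y D)) (map_prod \<tau> \<sigma>) circle uminus f"
    using f by (auto simp: z2_map_def simp flip: subtopology_Times intro: continuous_map_from_subtopology)
  moreover have "connected_space (subtopology X C)" "connected_space (subtopology Y D)"
    using C(1) D(1) connectedin_connected_components_of connectedin_def by metis+
  moreover have "compact_space (subtopology Y D)"
    using finite_z2_cw_complex_compact[OF assms(2)] closedin_connected_components_of[OF D(1)]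
    by (simp add: closedin_compact_space compact_space_subtopology)
  ultimately show False
    using z2_map_factor_connected[of "subtopology X C" \<tau> "subtopology Y D" \<sigma> f x0 y0]
      z2_space_invariant_component[OF z2(1) C(2) sub(1)]
      z2_space_invariant_component[OF z2(2) D(2) sub(2)]
      noC noD sub \<open>x0 \<in> C\<close> \<open>y0 \<in> D\<close> by auto
qed

end
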